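(* Let $(V^{[*]},d_V^{[*]},Y(\cdot,x),\mathbf 1)$ be a dg vertex algebra. Then there is an induced map $H(Y)(\cdot,x):H^{[*]}(V^{[*]})\to\operatorname{End}^{[*]}(H^{[*]}(V^{[*]}))[[x,x^{-1}]]$ defining a dg vertex algebra structure on the cohomology $H^{[*]}(V^{[*]})$ (regarded as a complex with zero differential), with vacuum vector the image of $\mathbf 1$ in $H^{[0]}(V^{[*]})$.
   Context: All vector spaces are over $\mathbb C$. A (cochain) complex $V^{[*]}=\bigoplus_{p\in\mathbb Z}V^{[p]}$ has a differential $d_V$ of degree $+1$ with $d_V^2=0$; $|v|=p$ for $v\in V^{[p]}$. $\operatorname{End}^{[*]}(V^{[*]})=\bigoplus_p\operatorname{End}^{[p]}(V^{[*]})$, where $\operatorname{End}^{[p]}$ is the space of linear maps of degree $p$. Cohomology is $H^{[*]}(V^{[*]})=\operatorname{Ker}d_V/\operatorname{Im}d_V$ with its grading. A dg vertex algebra $(V^{[*]},d_V,Y(\cdot,x),\mathbf 1)$ is a complex with a linear map $v\mapsto Y(v,x)=\sum_{n\in\mathbb Z}v_nx^{-n-1}\in\operatorname{End}^{[*]}(V^{[*]})[[x,x^{-1}]]$ which is a chain map when $x$ is given degree $-2$ and zero differential, i.e. for $v\in V^{[p]}$ one has $v_n\in\operatorname{End}^{[p-2n-2]}(V^{[*]})$ and $(d_Vv)_n=d_V\circ v_n-(-1)^{p}v_n\circ d_V$, and a vector $\mathbf 1\in V^{[0]}$ with $d_V\mathbf 1=0$, such that: (truncation) $u_nv=0$ for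 $n$ sufficiently large; (vacuum) $Y(\mathbf 1,x)=\operatorname{id}$; (creation) $Y(v,x)\mathbf 1\in V^{[*]}[[x]]$ with constant term $v$; (Jacobi identity) for homogeneous $u,v$ and all $l,m,n\in\mathbb Z$, $$\sum_{i\ge0}(-1)^i\binom li\left(u_{m+l-i}v_{n+i}-(-1)^{l}(-1)^{|u||v|}v_{n+l-i}u_{m+i}\right)=\sum_{i\ge0}\binom mi(u_{l+i}v)_{m+n-i}.$$ The induced map is the one determined by sending the class of a cocycle $v$ to $\sum_n\bar v_nx^{-n-1}$, where $\bar v_n$ is the map induced by $v_n$ on cohomology. *)

theory Defs
  imports "HOL-Algebra.Algebra" "HOL-Algebra.Algebraic_Closure_Type"
begin

abbreviation complex_ring :: "complex ring" where
  "complex_ring \<equiv> ring_of_type_algebra"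

text \<open>
  Vector spaces are modules over the ring of complex numbers. A record is used, rather than
  a type class, because cohomology is a quotient depending on the differential. The fields
  mult and one, inherited from the record of rings, carry no meaning.
\<close>

record 'a dg_space = "(complex, 'a) module" +
  component :: "int \<Rightarrow> 'a set"
  differential :: "'a \<Rightarrow> 'a"

definition linear_endo :: "'a dg_space \<Rightarrow> ('a \<Rightarrow> 'a) \<Rightarrow> bool" where
  "linear_endo V f \<longleftrightarrow>
     f \<in> carrier V \<rightarrow> carrier V \<and>
     (\<forall>x\<in>carrier V. \<forall>y\<in>carrier V. f (x \<oplus>\<^bsub>V\<^esub> y) = f x \<oplus>\<^bsub>V\<^esub> f y) \<and>
     (\<forall>c. \<forall>x\<in>carrier V. f (c \<odot>\<^bsub>V\<^esub> x) = c \<odot>\<^bsub>V\<^esub> f x)"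

definition End_degree :: "'a dg_space \<Rightarrow> int \<Rightarrow> ('a \<Rightarrow> 'a) set" where
  "End_degree V p =
     {f. linear_endo V f \<and> (\<forall>q. f \<in> component V q \<rightarrow> component V (q + p))}"

text \<open>
  Sum of a finitely supported family. (The library's finsum is zero on infinite index sets.)
\<close>

definition supp_sum :: "'a dg_space \<Rightarrow> ('i \<Rightarrow> 'a) \<Rightarrow> 'a" where
  "supp_sum V f = finsum V f {i. f i \<noteq> \<zero>\<^bsub>V\<^esub>}"

locale cochain_complex = module complex_ring V
  for V :: "'a dg_space" +
  assumes component_submodule: "submodule (component V p) complex_ring V"
    and direct_sum:
      "x \<in> carrier V \<Longrightarrow>
       \<exists>!f. (\<forall>p. f p \<in> component V p) \<and> finite {p. f p \<noteq> \<zero>\<^bsub>V\<^esub>} \<and> x = supp_sum V f"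
    and differential_degree: "differential V \<in> End_degree V 1"
    and differential_square: "x \<in> carrier V \<Longrightarrow> differential V (differential V x) = \<zero>\<^bsub>V\<^esub>"

text \<open>
  \<open>Y v n\<close> is the mode \<open>v\<^sub>n\<close>, the coefficient of \<open>x\<close> to the power \<open>-n-1\<close> in \<open>Y(v,x)\<close>.
  By linearity in \<open>v\<close> and the degree condition, every mode is a finite sum of homogeneous
  endomorphisms. In the Jacobi identity, applied to a vector \<open>w\<close>, truncation makes all the
  families finitely supported.
\<close>

locale dg_vertex_algebra = cochain_complex V
  for V :: "'a dg_space" and Y :: "'a \<Rightarrow> int \<Rightarrow> 'a \<Rightarrow> 'a" and vac :: 'a +
  assumes mode_linear: "v \<in> carrier V \<Longrightarrow> linear_endo V (Y v n)"
    and Y_add: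
      "\<lbrakk>u \<in> carrier V; v \<in> carrier V; w \<in> carrier V\<rbrakk> \<Longrightarrow>
       Y (u \<oplus>\<^bsub>V\<^esub> v) n w = Y u n w \<oplus>\<^bsub>V\<^esub> Y v n w"
    and Y_smult:
      "\<lbrakk>v \<in> carrier V; w \<in> carrier V\<rbrakk> \<Longrightarrow> Y (c \<odot>\<^bsub>V\<^esub> v) n w = c \<odot>\<^bsub>V\<^esub> Y v n w"
    and mode_degree: "v \<in> component V p \<Longrightarrow> Y v n \<in> End_degree V (p - 2 * n - 2)"
    and mode_differential:
      "\<lbrakk>v \<in> component V p; w \<in> carrier V\<rbrakk> \<Longrightarrow>
       Y (differential V v) n w =
       differential V (Y v n w) \<ominus>\<^bsub>V\<^esub> ((-1) powi p) \<odot>\<^bsub>V\<^esub> Y v n (differential V w)"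
    and vac_degree: "vac \<in> component V 0"
    and vac_closed: "differential V vac = \<zero>\<^bsub>V\<^esub>"
    and truncation:
      "\<lbrakk>u \<in> carrier V; v \<in> carrier V\<rbrakk> \<Longrightarrow> \<exists>N. \<forall>n\<ge>N. Y u n v = \<zero>\<^bsub>V\<^esub>"
    and vacuum: "w \<in> carrier V \<Longrightarrow> Y vac n w = (if n = -1 then w else \<zero>\<^bsub>V\<^esub>)"
    and creation_regular: "\<lbrakk>v \<in> carrier V; n \<ge> 0\<rbrakk> \<Longrightarrow> Y v n vac = \<zero>\<^bsub>V\<^esub>"
    and creation_constant: "v \<in> carrier V \<Longrightarrow> Y v (-1) vac = v"
    and jacobi:
      "\<lbrakk>u \<in> component V p; v \<in> component V q; w \<in> carrier V\<rbrakk> \<Longrightarrow>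
       supp_sum V (\<lambda>i::nat.
         ((-1) ^ i * (of_int l gchoose i)) \<odot>\<^bsub>V\<^esub>
           (Y u (m + l - int i) (Y v (n + int i) w) \<ominus>\<^bsub>V\<^esub>
            ((-1) powi l * (-1) powi (p * q)) \<odot>\<^bsub>V\<^esub> Y v (n + l - int i) (Y u (m + int i) w)))
       = supp_sum V (\<lambda>i::nat.
         (of_int m gchoose i) \<odot>\<^bsub>V\<^esub> Y (Y u (l + int i) v) (m + n - int i) w)"

definition cocycles :: "'a dg_space \<Rightarrow> 'a set" where
  "cocycles V = {v \<in> carrier V. differential V v = \<zero>\<^bsub>V\<^esub>}"

definition coboundaries :: "'a dg_space \<Rightarrow> 'a set" where
  "coboundaries V = differential V ` carrier V"

definition cohomology_class :: "'a dg_space \<Rightarrow> 'a \<Rightarrow> 'a set" where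
  "cohomology_class V v = coboundaries V +>\<^bsub>V\<^esub> v"

text \<open>
  The scalar multiple of a coset is defined as in the library's quotient rings, so that
  multiplication by 0 gives the coset of 0 and not the set \<open>{0}\<close>.
\<close>

definition cohomology :: "'a dg_space \<Rightarrow> 'a set dg_space" where
  "cohomology V =
     \<lparr>carrier = cohomology_class V ` cocycles V,
      monoid.mult = undefined,
      one = undefined,
      ring.zero = coboundaries V,
      add = set_add V,
      module.smult = (\<lambda>c A. \<Union>x\<in>A. cohomology_class V (c \<odot>\<^bsub>V\<^esub> x)),
      component = (\<lambda>p. cohomology_class V ` (cocycles V \<inter> component V p)),
      differential = (\<lambda>A. coboundaries V)\<rparr>"

definition induces_on_cohomology ::
    "'a dg_space \<Rightarrow> ('a \<Rightarrow> 'a) \<Rightarrow> ('a set \<Rightarrow> 'a set) \<Rightarrow> bool" where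
  "induces_on_cohomology V f g \<longleftrightarrow>
     f \<in> cocycles V \<rightarrow> cocycles V \<and>
     f \<in> coboundaries V \<rightarrow> coboundaries V \<and>
     (\<forall>w\<in>cocycles V. g (cohomology_class V w) = cohomology_class V (f w))"

end

theory Submission
  imports Defs
begin

text \<open>
  The modes satisfy the Leibniz rule
  \<open>(d v)\<^sub>n w = d (v\<^sub>n w) - (-1)\<^sup>p v\<^sub>n (d w)\<close> for \<open>v\<close> of degree \<open>p\<close>. Consequently \<open>v\<^sub>n w\<close> is a
  cocycle when \<open>v\<close> and \<open>w\<close> are cocycles, and it is a coboundary when one of them is moreover a
  coboundary (\<open>mode_cocycle\<close>, \<open>mode_coboundary_left\<close>, \<open>mode_coboundary_right\<close>). So
  \<open>[v]\<^sub>n [w] = [v\<^sub>n w]\<close> is well defined on cohomology (\<open>cohomology_mode_cls\<close>), and each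
  axiom for cohomology is the class of the same axiom applied to representing cocycles.

  Two points need care. The Leibniz rule is available for homogeneous \<open>v\<close> only, because of the
  sign, whereas a cocycle is a sum of elements of different degrees. As the differential is
  homogeneous, the homogeneous parts of a cocycle are again cocycles
  (\<open>homogeneous_part_cocycle\<close>), so the statements on modes follow by additivity from
  \<open>homogeneous_induct\<close>. The same compatibility of the differential with homogeneous parts makes
  the cohomology the direct sum of its components (\<open>cohomology_cochain_complex\<close>).

  Secondly, the Jacobi identity compares finitely supported sums, and the support of a family can
  shrink when classes are taken. The class map nevertheless commutes with these sums
  (\<open>cls_supp_sum\<close>), once truncation in the original algebra has shown that the families of
  representatives have finite support (\<open>cohomology_jacobi\<close>).
\<close>

section \<open>Finitely supported sums\<close>

lemma complex_ring_simps [simp]: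
  "carrier complex_ring = UNIV"
  "a \<oplus>\<^bsub>complex_ring\<^esub> b = a + b"
  "a \<otimes>\<^bsub>complex_ring\<^esub> b = a * b"
  "\<zero>\<^bsub>complex_ring\<^esub> = 0"
  "\<one>\<^bsub>complex_ring\<^esub> = 1"
  by (simp_all add: ring_of_type_algebra_def)

text \<open>
  Additivity of \<open>h\<close> on a subset \<open>S\<close> is assumed, instead of on the whole carrier, because the
  class map to cohomology respects addition in the target only between cocycles.
  On infinite index sets both sums are zero by convention.
\<close>

lemma finsum_additive:
  assumes "abelian_monoid G" "abelian_monoid H"
    and "S \<subseteq> carrier G" "\<zero>\<^bsub>G\<^esub> \<in> S" "\<And>x y. x \<in> S \<Longrightarrow> y \<in> S \<Longrightarrow> x \<oplus>\<^bsub>G\<^esub> y \<in> S"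
    and "h \<in> S \<rightarrow> carrier H" "h \<zero>\<^bsub>G\<^esub> = \<zero>\<^bsub>H\<^esub>"
    and "\<And>x y. x \<in> S \<Longrightarrow> y \<in> S \<Longrightarrow> h (x \<oplus>\<^bsub>G\<^esub> y) = h x \<oplus>\<^bsub>H\<^esub> h y"
    and "f \<in> A \<rightarrow> S"
  shows "finsum G f A \<in> S \<and> h (finsum G f A) = finsum H (\<lambda>i. h (f i)) A"
proof -
  interpret G: abelian_monoid G by fact
  interpret H: abelian_monoid H by fact
  show ?thesis
    using assms(9)
  proof (induct A rule: infinite_finite_induct)
    case (infinite A)
    then show ?case using assms(4,7) by (simp add: G.finsum_infinite H.finsum_infinite)
  next
    case empty
    then show ?case using assms(4,7) by simp
  next
    case (insert a A)
    have f: "f \<in> A \<rightarrow> carrier G" "f a \<in> carrier G" "f a \<in> S"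
      and hf: "(\<lambda>i. h (f i)) \<in> A \<rightarrow> carrier H" "h (f a) \<in> carrier H"
      using insert(4) assms(3,6) by auto
    show ?case
      using insert f hf assms(5,8) by (simp add: G.finsum_insert H.finsum_insert)
  qed
qed

lemma supp_sum_eq_finsum:
  assumes "abelian_monoid V" "finite A" "{i. f i \<noteq> \<zero>\<^bsub>V\<^esub>} \<subseteq> A" "\<And>i. f i \<in> carrier V"
  shows "supp_sum V f = finsum V f A"
proof -
  interpret abelian_monoid V by fact
  show ?thesis
    unfolding supp_sum_def
    by (rule add.finprod_mono_neutral_cong_left) (use assms in auto)
qed

lemma supp_sum_add:
  assumes "abelian_monoid V" "finite {i. f i \<noteq> \<zero>\<^bsub>V\<^esub>}" "finite {i. g i \<noteq> \<zero>\<^bsub>V\<^esub>}"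
    and "\<And>i. f i \<in> carrier V" "\<And>i. g i \<in> carrier V"
  shows "supp_sum V (\<lambda>i. f i \<oplus>\<^bsub>V\<^esub> g i) = supp_sum V f \<oplus>\<^bsub>V\<^esub> supp_sum V g"
proof -
  interpret abelian_monoid V by fact
  note eq = supp_sum_eq_finsum[OF assms(1)]
  let ?A = "{i. f i \<noteq> \<zero>\<^bsub>V\<^esub>} \<union> {i. g i \<noteq> \<zero>\<^bsub>V\<^esub>}"
  have "supp_sum V (\<lambda>i. f i \<oplus>\<^bsub>V\<^esub> g i) = finsum V (\<lambda>i. f i \<oplus>\<^bsub>V\<^esub> g i) ?A"
    by (rule eq) (use assms in auto)
  also have "\<dots> = finsum V f ?A \<oplus>\<^bsub>V\<^esub> finsum V g ?A"
    by (rule finsum_addf) (use assms in auto)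
  also have "\<dots> = supp_sum V f \<oplus>\<^bsub>V\<^esub> supp_sum V g"
    using assms eq[of ?A f] eq[of ?A g] by auto
  finally show ?thesis .
qed

lemma supp_sum_reindex:
  assumes "abelian_monoid V" "bij s" "\<And>i. f i \<in> carrier V"
  shows "supp_sum V (\<lambda>i. f (s i)) = supp_sum V f"
proof -
  interpret abelian_monoid V by fact
  have inj: "inj_on s {i. f (s i) \<noteq> \<zero>\<^bsub>V\<^esub>}"
    using assms(2) by (auto simp: bij_def intro: inj_on_subset)
  have img: "s ` {i. f (s i) \<noteq> \<zero>\<^bsub>V\<^esub>} = {i. f i \<noteq> \<zero>\<^bsub>V\<^esub>}"
    using assms(2) by (force simp: bij_def surj_def image_iff)
  show ?thesis
    unfolding supp_sum_def using finsum_reindex[OF _ inj, of f] assms(3) img by simp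
qed

text \<open>
  The image family may have a smaller support than the family itself. The missing terms are zero,
  so the sum of the images can be taken over the original support.
\<close>

lemma supp_sum_additive:
  assumes "abelian_monoid V" "abelian_monoid W"
    and "S \<subseteq> carrier V" "\<zero>\<^bsub>V\<^esub> \<in> S" "\<And>x y. x \<in> S \<Longrightarrow> y \<in> S \<Longrightarrow> x \<oplus>\<^bsub>V\<^esub> y \<in> S"
    and "h \<in> S \<rightarrow> carrier W" "h \<zero>\<^bsub>V\<^esub> = \<zero>\<^bsub>W\<^esub>"
    and "\<And>x y. x \<in> S \<Longrightarrow> y \<in> S \<Longrightarrow> h (x \<oplus>\<^bsub>V\<^esub> y) = h x \<oplus>\<^bsub>W\<^esub> h y"
    and "\<And>i. f i \<in> S" "finite {i. f i \<noteq> \<zero>\<^bsub>V\<^esub>}"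
  shows "supp_sum V f \<in> S" "h (supp_sum V f) = supp_sum W (\<lambda>i. h (f i))"
proof -
  have f: "supp_sum V f \<in> S \<and> h (supp_sum V f) = finsum W (\<lambda>i. h (f i)) {i. f i \<noteq> \<zero>\<^bsub>V\<^esub>}"
    unfolding supp_sum_def
    by (rule finsum_additive[OF assms(1-8)]) (use assms(9) in auto)
  then show "supp_sum V f \<in> S" ..
  have "supp_sum W (\<lambda>i. h (f i)) = finsum W (\<lambda>i. h (f i)) {i. f i \<noteq> \<zero>\<^bsub>V\<^esub>}"
    by (rule supp_sum_eq_finsum[OF assms(2)]) (use assms(6,7,9,10) in auto)
  then show "h (supp_sum V f) = supp_sum W (\<lambda>i. h (f i))" using f by simp
qed

section \<open>Homogeneous components in a cochain complex\<close>

definition homogeneous_part :: "'a dg_space \<Rightarrow> 'a \<Rightarrow> int \<Rightarrow> 'a" where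
  "homogeneous_part V x =
     (THE f. (\<forall>p. f p \<in> component V p) \<and> finite {p. f p \<noteq> \<zero>\<^bsub>V\<^esub>} \<and> x = supp_sum V f)"

context cochain_complex
begin

lemma homogeneous_part:
  assumes "x \<in> carrier V"
  shows "homogeneous_part V x p \<in> component V p"
    and "finite {p. homogeneous_part V x p \<noteq> \<zero>\<^bsub>V\<^esub>}"
    and "supp_sum V (homogeneous_part V x) = x"
  using theI'[OF direct_sum[OF assms]] unfolding homogeneous_part_def by auto

lemma homogeneous_part_eqI:
  assumes "x \<in> carrier V" "\<And>p. f p \<in> component V p" "finite {p. f p \<noteq> \<zero>\<^bsub>V\<^esub>}" "x = supp_sum V f"
  shows "homogeneous_part V x = f"
  unfolding homogeneous_part_def
  by (rule the1_equality[OF direct_sum[OF assms(1)]]) (use assms in auto)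

lemmas component_submoduleE = submoduleE[OF component_submodule]

lemma component_carrier: "x \<in> component V p \<Longrightarrow> x \<in> carrier V"
  using component_submoduleE(1) by blast

lemma component_zero: "\<zero>\<^bsub>V\<^esub> \<in> component V p"
proof -
  obtain x where x: "x \<in> component V p" using component_submoduleE(2) by blast
  then have "0 \<odot>\<^bsub>V\<^esub> x \<in> component V p" using component_submoduleE(4) by simp
  then show ?thesis using smult_l_null component_carrier[OF x] by simp
qed

lemma homogeneous_part_carrier:
  "x \<in> carrier V \<Longrightarrow> homogeneous_part V x p \<in> carrier V"
  using homogeneous_part(1) component_carrier by blast

lemma homogeneous_part_add:
  assumes "x \<in> carrier V" "y \<in> carrier V"
  shows "homogeneous_part V (x \<oplus>\<^bsub>V\<^esub> y) =
    (\<lambda>p. homogeneous_part V x p \<oplus>\<^bsub>V\<^esub> homogeneous_part V y p)"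
proof (rule homogeneous_part_eqI)
  show "finite {p. homogeneous_part V x p \<oplus>\<^bsub>V\<^esub> homogeneous_part V y p \<noteq> \<zero>\<^bsub>V\<^esub>}"
    by (rule finite_subset[OF _ finite_UnI[OF homogeneous_part(2)[OF assms(1)] homogeneous_part(2)[OF assms(2)]]])
      auto
  show "x \<oplus>\<^bsub>V\<^esub> y = supp_sum V (\<lambda>p. homogeneous_part V x p \<oplus>\<^bsub>V\<^esub> homogeneous_part V y p)"
    using assms by (simp add: supp_sum_add[OF M.abelian_monoid_axioms] homogeneous_part homogeneous_part_carrier)
qed (use assms homogeneous_part(1) component_submoduleE(5) in auto)

lemma homogeneous_part_zero: "homogeneous_part V \<zero>\<^bsub>V\<^esub> = (\<lambda>p. \<zero>\<^bsub>V\<^esub>)"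
  by (rule homogeneous_part_eqI) (auto simp: component_zero supp_sum_def)

text \<open>
  This extends to arbitrary vectors a property that is additive and is known in each degree. The
  last premise concerns the homogeneous parts of \<open>x\<close> alone, so that further information on \<open>x\<close>,
  such as being a cocycle, can be used for them.
\<close>

lemma homogeneous_induct [consumes 1, case_names zero add part]:
  assumes "x \<in> carrier V" "P \<zero>\<^bsub>V\<^esub>"
    and "\<And>y z. y \<in> carrier V \<Longrightarrow> z \<in> carrier V \<Longrightarrow> P y \<Longrightarrow> P z \<Longrightarrow> P (y \<oplus>\<^bsub>V\<^esub> z)"
    and "\<And>p. P (homogeneous_part V x p)"
  shows "P x"
proof -
  have "supp_sum V (homogeneous_part V x) \<in> {y \<in> carrier V. P y}"
    unfolding supp_sum_def
    by (rule conjunct1, rule finsum_additive[OF M.abelian_monoid_axioms M.abelian_monoid_axioms, of _ id])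
      (use assms homogeneous_part_carrier[OF assms(1)] in auto)
  then show ?thesis using homogeneous_part(3)[OF assms(1)] by simp
qed

lemma a_minus_zero: "x \<in> carrier V \<Longrightarrow> x \<ominus>\<^bsub>V\<^esub> \<zero>\<^bsub>V\<^esub> = x"
  using M.minus_equality[of "\<zero>\<^bsub>V\<^esub>" "\<zero>\<^bsub>V\<^esub>"] by (simp add: a_minus_def)

lemma eq_if_a_minus_eq_zero:
  assumes "x \<in> carrier V" "y \<in> carrier V" "x \<ominus>\<^bsub>V\<^esub> y = \<zero>\<^bsub>V\<^esub>"
  shows "x = y"
  using M.minus_equality[of x "\<ominus>\<^bsub>V\<^esub> y"] assms by (simp add: a_minus_def)

lemma differential_closed: "x \<in> carrier V \<Longrightarrow> differential V x \<in> carrier V"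
  and differential_add: "x \<in> carrier V \<Longrightarrow> y \<in> carrier V \<Longrightarrow>
    differential V (x \<oplus>\<^bsub>V\<^esub> y) = differential V x \<oplus>\<^bsub>V\<^esub> differential V y"
  and differential_smult: "x \<in> carrier V \<Longrightarrow>
    differential V (c \<odot>\<^bsub>V\<^esub> x) = c \<odot>\<^bsub>V\<^esub> differential V x"
  and differential_component: "x \<in> component V p \<Longrightarrow> differential V x \<in> component V (p + 1)"
  using differential_degree unfolding End_degree_def linear_endo_def by auto

lemma linear_endo_zero: "linear_endo V f \<Longrightarrow> f \<zero>\<^bsub>V\<^esub> = \<zero>\<^bsub>V\<^esub>"
  unfolding linear_endo_def
  by (metis M.zero_closed PiE UNIV_I complex_ring_simps(1) complex_ring_simps(4) smult_l_null smult_r_null)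

lemma differential_zero: "differential V \<zero>\<^bsub>V\<^esub> = \<zero>\<^bsub>V\<^esub>"
  using differential_degree linear_endo_zero unfolding End_degree_def by auto

text \<open>
  Applying the differential to the decomposition of \<open>x\<close> gives a decomposition of \<open>d x\<close> with the
  degrees shifted by one. Decompositions are unique.
\<close>

lemma homogeneous_part_differential:
  assumes x: "x \<in> carrier V"
  shows "homogeneous_part V (differential V x) = (\<lambda>p. differential V (homogeneous_part V x (p - 1)))"
proof (rule homogeneous_part_eqI)
  let ?h = "homogeneous_part V x"
  show "differential V (?h (p - 1)) \<in> component V p" for p
    using differential_component[OF homogeneous_part(1)[OF x, of "p - 1"]] by simp
  have "{p. differential V (?h (p - 1)) \<noteq> \<zero>\<^bsub>V\<^esub>} \<subseteq> (\<lambda>p. p + 1) ` {p. ?h p \<noteq> \<zero>\<^bsub>V\<^esub>}"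
  proof
    fix p assume "p \<in> {p. differential V (?h (p - 1)) \<noteq> \<zero>\<^bsub>V\<^esub>}"
    then have "?h (p - 1) \<noteq> \<zero>\<^bsub>V\<^esub>" using differential_zero by auto
    then show "p \<in> (\<lambda>p. p + 1) ` {p. ?h p \<noteq> \<zero>\<^bsub>V\<^esub>}" by (intro image_eqI[of _ _ "p - 1"]) auto
  qed
  then show "finite {p. differential V (?h (p - 1)) \<noteq> \<zero>\<^bsub>V\<^esub>}"
    using homogeneous_part(2)[OF x] by (auto intro: finite_subset)
  have bij: "bij (\<lambda>p::int. p - 1)" by (rule bijI') (auto intro: exI[of _ "_ + 1"])
  have "differential V x = differential V (supp_sum V ?h)" using homogeneous_part(3)[OF x] by simp
  also have "\<dots> = supp_sum V (\<lambda>p. differential V (?h p))"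
    by (rule supp_sum_additive(2)[OF M.abelian_monoid_axioms M.abelian_monoid_axioms, of "carrier V"])
      (use x in \<open>auto simp: differential_closed differential_add differential_zero
        homogeneous_part homogeneous_part_carrier\<close>)
  also have "\<dots> = supp_sum V (\<lambda>p. differential V (?h (p - 1)))"
    using supp_sum_reindex[OF M.abelian_monoid_axioms bij, of "\<lambda>p. differential V (?h p)"]
    by (simp add: differential_closed homogeneous_part_carrier[OF x])
  finally show "differential V x = supp_sum V (\<lambda>p. differential V (?h (p - 1)))" .
qed (use x differential_closed in auto)

section \<open>Cohomology of a cochain complex\<close>

lemma cocycles_submodule: "submodule (cocycles V) complex_ring V"
proof (rule submoduleI)
  show "\<ominus>\<^bsub>V\<^esub> a \<in> cocycles V" if "a \<in> cocycles V" for a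
  proof -
    have a: "a \<in> carrier V" "differential V a = \<zero>\<^bsub>V\<^esub>" using that by (auto simp: cocycles_def)
    have "differential V (\<ominus>\<^bsub>V\<^esub> a) \<oplus>\<^bsub>V\<^esub> differential V a = \<zero>\<^bsub>V\<^esub>"
      using a differential_add[of "\<ominus>\<^bsub>V\<^esub> a" a] by (simp add: M.l_neg differential_zero)
    then show ?thesis using a by (simp add: cocycles_def differential_closed)
  qed
qed (auto simp: cocycles_def differential_zero differential_add differential_smult)

lemma zero_coboundary: "\<zero>\<^bsub>V\<^esub> \<in> coboundaries V"
  unfolding coboundaries_def using differential_zero by (intro image_eqI[of _ _ "\<zero>\<^bsub>V\<^esub>"]) auto

lemma coboundaries_submodule: "submodule (coboundaries V) complex_ring V"
proof (rule submoduleI)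
  show "coboundaries V \<subseteq> carrier V" by (auto simp: coboundaries_def differential_closed)
  show "\<zero>\<^bsub>V\<^esub> \<in> coboundaries V" by (rule zero_coboundary)
  show add: "a \<oplus>\<^bsub>V\<^esub> b \<in> coboundaries V" if "a \<in> coboundaries V" "b \<in> coboundaries V" for a b
    using that unfolding coboundaries_def by (auto simp: differential_add[symmetric])
  show smult: "c \<odot>\<^bsub>V\<^esub> a \<in> coboundaries V" if "a \<in> coboundaries V" for c a
    using that unfolding coboundaries_def by (auto simp: differential_smult[symmetric])
  show "\<ominus>\<^bsub>V\<^esub> a \<in> coboundaries V" if "a \<in> coboundaries V" for a
  proof -
    have a: "a \<in> carrier V" using that by (auto simp: coboundaries_def differential_closed)
    have "\<ominus>\<^bsub>complex_ring\<^esub> 1 \<odot>\<^bsub>V\<^esub> a = \<ominus>\<^bsub>V\<^esub> a"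
      using smult_l_minus[of 1 a] smult_one[OF a] a by simp
    then show ?thesis using smult[OF that] by metis
  qed
qed

lemmas cocyclesE = submoduleE[OF cocycles_submodule]
lemmas coboundariesE = submoduleE[OF coboundaries_submodule]

lemma cocycles_carrier: "x \<in> cocycles V \<Longrightarrow> x \<in> carrier V"
  by (simp add: cocycles_def)

lemma zero_cocycle: "\<zero>\<^bsub>V\<^esub> \<in> cocycles V"
  by (simp add: cocycles_def differential_zero)

lemma cocycles_minus: "x \<in> cocycles V \<Longrightarrow> y \<in> cocycles V \<Longrightarrow> x \<ominus>\<^bsub>V\<^esub> y \<in> cocycles V"
  using cocyclesE(3,5) by (simp add: a_minus_def)

lemma coboundaries_cocycles: "coboundaries V \<subseteq> cocycles V"
  by (auto simp: coboundaries_def cocycles_def differential_closed differential_square)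

text \<open>
  If \<open>d x = 0\<close>, all homogeneous parts of \<open>d x\<close> vanish, and these are the differentials of the
  homogeneous parts of \<open>x\<close>.
\<close>

lemma homogeneous_part_cocycle:
  assumes "x \<in> cocycles V"
  shows "homogeneous_part V x p \<in> cocycles V"
proof -
  have x: "x \<in> carrier V" "differential V x = \<zero>\<^bsub>V\<^esub>" using assms by (auto simp: cocycles_def)
  have "differential V (homogeneous_part V x p) = homogeneous_part V (differential V x) (p + 1)"
    using homogeneous_part_differential[OF x(1)] by simp
  then show ?thesis
    using x by (simp add: cocycles_def homogeneous_part_zero homogeneous_part_carrier)
qed

sublocale B: abelian_subgroup "coboundaries V" V
  by (rule abelian_subgroupI3)
    (use coboundaries_submodule M.abelian_group_axioms in
      \<open>auto simp: submodule_def intro: additive_subgroup.intro\<close>)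

abbreviation cls :: "'a \<Rightarrow> 'a set" where
  "cls \<equiv> cohomology_class V"

lemma cls_eq_iff:
  assumes "x \<in> carrier V" "y \<in> carrier V"
  shows "cls x = cls y \<longleftrightarrow> x \<ominus>\<^bsub>V\<^esub> y \<in> coboundaries V"
  unfolding cohomology_class_def
  using assms B.a_rcos_module B.a_repr_independence' B.a_repr_independenceD
  unfolding a_minus_def by metis

lemma mem_cls: "x \<in> carrier V \<Longrightarrow> x \<in> cls x"
  unfolding cohomology_class_def by (rule B.a_rcos_self)

lemma cls_add_coboundary:
  assumes "b \<in> coboundaries V" "x \<in> carrier V"
  shows "cls (b \<oplus>\<^bsub>V\<^esub> x) = cls x"
proof -
  have "b \<in> carrier V" using assms coboundariesE(1) by auto
  then show ?thesis
    using assms cls_eq_iff[of "b \<oplus>\<^bsub>V\<^esub> x" x] by (simp add: a_minus_def M.a_assoc M.r_neg)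
qed

lemma cls_memE:
  assumes "y \<in> cls x"
  obtains b where "b \<in> coboundaries V" "y = b \<oplus>\<^bsub>V\<^esub> x"
  using assms that unfolding cohomology_class_def a_r_coset_def' by blast

lemma cls_add:
  "x \<in> carrier V \<Longrightarrow> y \<in> carrier V \<Longrightarrow> set_add V (cls x) (cls y) = cls (x \<oplus>\<^bsub>V\<^esub> y)"
  unfolding cohomology_class_def by (rule B.a_rcos_sum)

lemma cls_zero: "cls \<zero>\<^bsub>V\<^esub> = coboundaries V"
  unfolding cohomology_class_def using coboundariesE(1) by (simp add: M.a_coset_add_zero)

lemma cls_smult:
  assumes "x \<in> carrier V"
  shows "(\<Union>y\<in>cls x. cls (c \<odot>\<^bsub>V\<^esub> y)) = cls (c \<odot>\<^bsub>V\<^esub> x)"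
proof -
  have "cls (c \<odot>\<^bsub>V\<^esub> y) = cls (c \<odot>\<^bsub>V\<^esub> x)" if y: "y \<in> cls x" for y
  proof -
    obtain b where b: "b \<in> coboundaries V" "y = b \<oplus>\<^bsub>V\<^esub> x" using y by (rule cls_memE)
    then have "c \<odot>\<^bsub>V\<^esub> y = c \<odot>\<^bsub>V\<^esub> b \<oplus>\<^bsub>V\<^esub> c \<odot>\<^bsub>V\<^esub> x"
      using assms coboundariesE(1) by (auto simp: smult_r_distr)
    then show ?thesis using cls_add_coboundary coboundariesE(4)[of c b] b assms by simp
  qed
  then show ?thesis using mem_cls[OF assms] by blast
qed

text \<open>
  Zero is written as a class, instead of as the set of coboundaries. Every element of cohomology
  occurring below then has the form \<open>cls x\<close>, and the rules for addition, scalar multiplication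
  and modes reduce each axiom to an identity between representatives.
\<close>

lemma cohomology_simps [simp]:
  "carrier (cohomology V) = cls ` cocycles V"
  "\<zero>\<^bsub>cohomology V\<^esub> = cls \<zero>\<^bsub>V\<^esub>"
  "component (cohomology V) p = cls ` (cocycles V \<inter> component V p)"
  "differential (cohomology V) A = cls \<zero>\<^bsub>V\<^esub>"
  by (simp_all add: cohomology_def cls_zero)

lemma cohomology_add [simp]:
  "x \<in> cocycles V \<Longrightarrow> y \<in> cocycles V \<Longrightarrow> cls x \<oplus>\<^bsub>cohomology V\<^esub> cls y = cls (x \<oplus>\<^bsub>V\<^esub> y)"
  by (simp add: cohomology_def cls_add cocycles_carrier)

lemma cohomology_smult [simp]:
  "x \<in> cocycles V \<Longrightarrow> c \<odot>\<^bsub>cohomology V\<^esub> cls x = cls (c \<odot>\<^bsub>V\<^esub> x)"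
  by (simp add: cohomology_def cls_smult cocycles_carrier)

lemma cohomology_abelian_group: "abelian_group (cohomology V)"
proof (rule abelian_groupI)
  fix A assume "A \<in> carrier (cohomology V)"
  then obtain x where x: "x \<in> cocycles V" "A = cls x" by auto
  show "\<exists>B\<in>carrier (cohomology V). B \<oplus>\<^bsub>cohomology V\<^esub> A = \<zero>\<^bsub>cohomology V\<^esub>"
    using x cocyclesE(3)[of x] cocycles_carrier[of x]
    by (intro bexI[of _ "cls (\<ominus>\<^bsub>V\<^esub> x)"]) (auto simp: M.l_neg)
qed (auto simp: cocyclesE(5) M.a_ac cocycles_carrier zero_cocycle)

lemma cohomology_module: "module complex_ring (cohomology V)"
  by (rule moduleI[OF R.is_cring cohomology_abelian_group])
    (auto simp: cocyclesE(4,5) smult_l_distr[simplified complex_ring_simps] smult_r_distr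
      smult_assoc1[simplified complex_ring_simps] smult_one[simplified complex_ring_simps]
      cocycles_carrier)

lemma cohomology_a_inv:
  assumes "x \<in> cocycles V"
  shows "\<ominus>\<^bsub>cohomology V\<^esub> cls x = cls (\<ominus>\<^bsub>V\<^esub> x)"
  by (rule abelian_group.minus_equality[OF cohomology_abelian_group])
    (use assms cocyclesE(3) cocycles_carrier in \<open>auto simp: M.l_neg\<close>)

lemma cohomology_minus [simp]:
  "x \<in> cocycles V \<Longrightarrow> y \<in> cocycles V \<Longrightarrow> cls x \<ominus>\<^bsub>cohomology V\<^esub> cls y = cls (x \<ominus>\<^bsub>V\<^esub> y)"
  using cocyclesE(3) by (simp add: a_minus_def cohomology_a_inv)

lemma cls_supp_sum:
  assumes "\<And>i. f i \<in> cocycles V" "finite {i. f i \<noteq> \<zero>\<^bsub>V\<^esub>}"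
  shows "supp_sum V f \<in> cocycles V"
    and "cls (supp_sum V f) = supp_sum (cohomology V) (\<lambda>i. cls (f i))"
  by (rule supp_sum_additive[OF M.abelian_monoid_axioms
        abelian_group.axioms(1)[OF cohomology_abelian_group],
        of "cocycles V" cls];
      use assms cocycles_carrier zero_cocycle cocyclesE(5) in auto)+

text \<open>
  The point is the direct sum decomposition. The class of \<open>x\<close> is the sum of the classes of the
  homogeneous parts of \<open>x\<close>. For uniqueness, represent another decomposition by cocycles
  \<open>a\<^sub>p\<close>, so that \<open>x = d y + s\<close> where \<open>s\<close> is the sum of the \<open>a\<^sub>p\<close>. The part of degree \<open>p\<close> of
  this equation says that the part of \<open>x\<close> differs from \<open>a\<^sub>p\<close> by the coboundary of the part of \<open>y\<close>
  of degree \<open>p - 1\<close>.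
\<close>

lemma cohomology_cochain_complex: "cochain_complex (cohomology V)"
proof (intro cochain_complex.intro cochain_complex_axioms.intro)
  show "module complex_ring (cohomology V)" by (rule cohomology_module)
  show "submodule (component (cohomology V) p) complex_ring (cohomology V)" for p
    by (rule module.submoduleI[OF cohomology_module])
      (auto simp: cohomology_a_inv zero_cocycle component_zero
        intro!: imageI cocyclesE(3-5) component_submoduleE(3-5))
  show "differential (cohomology V) \<in> End_degree (cohomology V) 1"
    by (auto simp: End_degree_def linear_endo_def zero_cocycle component_zero cocyclesE(4,5))
  show "differential (cohomology V) (differential (cohomology V) A) = \<zero>\<^bsub>cohomology V\<^esub>" for A
    by simp
next
  fix A assume "A \<in> carrier (cohomology V)"
  then obtain x where x: "x \<in> cocycles V" "A = cls x" by auto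
  let ?h = "homogeneous_part V x"
  have xV: "x \<in> carrier V" and hZ: "?h p \<in> cocycles V" for p
    using x cocycles_carrier homogeneous_part_cocycle by auto
  show "\<exists>!f. (\<forall>p. f p \<in> component (cohomology V) p) \<and> finite {p. f p \<noteq> \<zero>\<^bsub>cohomology V\<^esub>} \<and>
      A = supp_sum (cohomology V) f"
  proof (rule ex1I, intro conjI allI)
    show "cls (?h p) \<in> component (cohomology V) p" for p
      using hZ homogeneous_part(1)[OF xV] by simp
    show "finite {p. cls (?h p) \<noteq> \<zero>\<^bsub>cohomology V\<^esub>}"
      by (rule finite_subset[OF _ homogeneous_part(2)[OF xV]]) auto
    show "A = supp_sum (cohomology V) (\<lambda>p. cls (?h p))"
      using cls_supp_sum(2)[OF hZ homogeneous_part(2)[OF xV]] homogeneous_part(3)[OF xV] x by simp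
  next
    fix g
    assume g: "(\<forall>p. g p \<in> component (cohomology V) p) \<and> finite {p. g p \<noteq> \<zero>\<^bsub>cohomology V\<^esub>} \<and>
      A = supp_sum (cohomology V) g"
    \<comment> \<open>The zero class must be represented by the zero vector, for otherwise the family of
      representatives could have infinite support.\<close>
    have "\<exists>a. a \<in> cocycles V \<inter> component V p \<and> g p = cls a \<and> (g p = cls \<zero>\<^bsub>V\<^esub> \<longrightarrow> a = \<zero>\<^bsub>V\<^esub>)" for p
    proof (cases "g p = cls \<zero>\<^bsub>V\<^esub>")
      case True
      then show ?thesis using zero_cocycle component_zero by auto
    next
      case False
      then show ?thesis using g by (auto simp: image_iff)
    qed
    then obtain a where a: "\<And>p. a p \<in> cocycles V" "\<And>p. a p \<in> component V p" "\<And>p. g p = cls (a p)"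
      "\<And>p. g p = cls \<zero>\<^bsub>V\<^esub> \<Longrightarrow> a p = \<zero>\<^bsub>V\<^esub>"
      by (metis IntE)
    have fin: "finite {p. a p \<noteq> \<zero>\<^bsub>V\<^esub>}"
      by (rule finite_subset[OF _ conjunct1[OF conjunct2[OF g]]]) (use a(4) in auto)
    let ?s = "supp_sum V a"
    have s: "?s \<in> cocycles V" "A = cls ?s"
      using cls_supp_sum[OF a(1) fin] g ext[of g, OF a(3)] by simp_all
    have "x \<in> cls ?s" using x s mem_cls[OF xV] by simp
    then obtain b where b: "b \<in> coboundaries V" "x = b \<oplus>\<^bsub>V\<^esub> ?s" by (rule cls_memE)
    then obtain y where y: "y \<in> carrier V" "x = differential V y \<oplus>\<^bsub>V\<^esub> ?s"
      unfolding coboundaries_def by blast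
    have hs: "homogeneous_part V ?s = a"
      by (rule homogeneous_part_eqI) (use s a fin cocycles_carrier in auto)
    show "g = (\<lambda>p. cls (?h p))"
    proof
      fix p
      have "?h p = differential V (homogeneous_part V y (p - 1)) \<oplus>\<^bsub>V\<^esub> a p"
        using y s cocycles_carrier
        by (simp add: homogeneous_part_add homogeneous_part_differential differential_closed hs)
      moreover have "differential V (homogeneous_part V y (p - 1)) \<in> coboundaries V"
        using homogeneous_part_carrier[OF y(1)] by (simp add: coboundaries_def)
      ultimately show "g p = cls (?h p)"
        using cls_add_coboundary a cocycles_carrier by simp
    qed
  qed
qed

end

section \<open>Modes on cohomology\<close>

text \<open>
  The union over all representatives avoids choosing them. On two cohomology classes all sets in
  the union coincide.
\<close>

definition cohomology_mode ::
    "'a dg_space \<Rightarrow> ('a \<Rightarrow> int \<Rightarrow> 'a \<Rightarrow> 'a) \<Rightarrow> 'a set \<Rightarrow> int \<Rightarrow> 'a set \<Rightarrow> 'a set" where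
  "cohomology_mode V Y A n C = (\<Union>v\<in>A. \<Union>w\<in>C. cohomology_class V (Y v n w))"

context dg_vertex_algebra
begin

lemma mode_closed: "v \<in> carrier V \<Longrightarrow> w \<in> carrier V \<Longrightarrow> Y v n w \<in> carrier V"
  and mode_add: "v \<in> carrier V \<Longrightarrow> w \<in> carrier V \<Longrightarrow> w' \<in> carrier V \<Longrightarrow>
    Y v n (w \<oplus>\<^bsub>V\<^esub> w') = Y v n w \<oplus>\<^bsub>V\<^esub> Y v n w'"
  and mode_smult: "v \<in> carrier V \<Longrightarrow> w \<in> carrier V \<Longrightarrow> Y v n (c \<odot>\<^bsub>V\<^esub> w) = c \<odot>\<^bsub>V\<^esub> Y v n w"
  using mode_linear[of v n] unfolding linear_endo_def by auto

lemma mode_zero_right: "v \<in> carrier V \<Longrightarrow> Y v n \<zero>\<^bsub>V\<^esub> = \<zero>\<^bsub>V\<^esub>"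
  using mode_linear linear_endo_zero by blast

lemma mode_zero_left: "w \<in> carrier V \<Longrightarrow> Y \<zero>\<^bsub>V\<^esub> n w = \<zero>\<^bsub>V\<^esub>"
  using Y_smult[of "\<zero>\<^bsub>V\<^esub>" w 0 n] smult_l_null[simplified complex_ring_simps] mode_closed by simp

text \<open>
  For homogeneous \<open>v\<close> the two other terms of the Leibniz rule contain \<open>d v = 0\<close> or \<open>d w = 0\<close>.
\<close>

lemma mode_cocycle:
  assumes "v \<in> cocycles V" "w \<in> cocycles V"
  shows "Y v n w \<in> cocycles V"
  using cocycles_carrier[OF assms(1)]
proof (induct rule: homogeneous_induct)
  case zero
  then show ?case using assms cocycles_carrier zero_cocycle by (simp add: mode_zero_left)
next
  case (add y z)
  then show ?case using assms cocycles_carrier cocyclesE(5) by (simp add: Y_add)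
next
  case (part p)
  let ?v = "homogeneous_part V v p"
  have v: "?v \<in> component V p" "?v \<in> carrier V" "differential V ?v = \<zero>\<^bsub>V\<^esub>"
    and w: "w \<in> carrier V" "differential V w = \<zero>\<^bsub>V\<^esub>"
    using assms homogeneous_part_cocycle[OF assms(1)] homogeneous_part(1) by (auto simp: cocycles_def)
  have "\<zero>\<^bsub>V\<^esub> = differential V (Y ?v n w)"
    using mode_differential[OF v(1) w(1), of n] v w
    by (simp add: mode_zero_left mode_zero_right mode_closed differential_closed a_minus_zero)
  then show ?case using v w by (simp add: cocycles_def mode_closed)
qed

text \<open>
  For a homogeneous cocycle \<open>v\<close> of degree \<open>p\<close>, the Leibniz rule reads
  \<open>v\<^sub>n (d y) = (-1)\<^sup>p d (v\<^sub>n y)\<close>.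
\<close>

lemma mode_coboundary_right:
  assumes "v \<in> cocycles V" "w \<in> coboundaries V"
  shows "Y v n w \<in> coboundaries V"
  using cocycles_carrier[OF assms(1)]
proof (induct rule: homogeneous_induct)
  case zero
  then show ?case using assms coboundariesE(1) zero_coboundary mode_zero_left by auto
next
  case (add y z)
  moreover have "w \<in> carrier V" using assms coboundariesE(1) by auto
  ultimately show ?case using coboundariesE(5) by (simp add: Y_add)
next
  case (part p)
  let ?v = "homogeneous_part V v p"
  let ?e = "(-1) powi p :: complex"
  obtain y where y: "y \<in> carrier V" "w = differential V y" using assms(2) by (auto simp: coboundaries_def)
  have v: "?v \<in> component V p" "?v \<in> carrier V" "differential V ?v = \<zero>\<^bsub>V\<^esub>"
    using assms homogeneous_part_cocycle[OF assms(1)] homogeneous_part(1) by (auto simp: cocycles_def)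
  have wV: "w \<in> carrier V" using y differential_closed by simp
  have "\<zero>\<^bsub>V\<^esub> = differential V (Y ?v n y) \<ominus>\<^bsub>V\<^esub> ?e \<odot>\<^bsub>V\<^esub> Y ?v n w"
    using mode_differential[OF v(1) y(1), of n] v y by (simp add: mode_zero_left)
  then have "?e \<odot>\<^bsub>V\<^esub> Y ?v n w = differential V (Y ?v n y)"
    using eq_if_a_minus_eq_zero[of "differential V (Y ?v n y)" "?e \<odot>\<^bsub>V\<^esub> Y ?v n w"] v y wV
    by (simp add: mode_closed differential_closed)
  then have "?e \<odot>\<^bsub>V\<^esub> Y ?v n w \<in> coboundaries V"
    using v y by (simp add: coboundaries_def mode_closed)
  \<comment> \<open>The sign is its own inverse, so multiplying by it once more removes it.\<close>
  then have "?e \<odot>\<^bsub>V\<^esub> (?e \<odot>\<^bsub>V\<^esub> Y ?v n w) \<in> coboundaries V"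
    using coboundariesE(4) by simp
  moreover have "?e * ?e = 1" by (simp flip: power_int_mult_distrib)
  ultimately show ?case
    using smult_assoc1[of ?e ?e "Y ?v n w"] smult_one[of "Y ?v n w"] v wV by (simp add: mode_closed)
qed

text \<open>
  For homogeneous \<open>x\<close> and a cocycle \<open>w\<close>, the Leibniz rule reads \<open>(d x)\<^sub>n w = d (x\<^sub>n w)\<close>. The
  induction runs over the preimage \<open>x\<close> and not over the coboundary, because the homogeneous
  parts of \<open>x\<close> are what this formula needs.
\<close>

lemma mode_coboundary_left:
  assumes "v \<in> coboundaries V" "w \<in> cocycles V"
  shows "Y v n w \<in> coboundaries V"
proof -
  obtain x where x: "x \<in> carrier V" "v = differential V x" using assms(1) by (auto simp: coboundaries_def)
  have w: "w \<in> carrier V" "differential V w = \<zero>\<^bsub>V\<^esub>" using assms(2) by (auto simp: cocycles_def)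
  have "Y (differential V x) n w \<in> coboundaries V"
    using x(1)
  proof (induct rule: homogeneous_induct)
    case zero
    then show ?case using w zero_coboundary by (simp add: differential_zero mode_zero_left)
  next
    case (add y z)
    then show ?case using w coboundariesE(5)
      by (simp add: differential_add Y_add differential_closed)
  next
    case (part p)
    let ?x = "homogeneous_part V x p"
    have p: "?x \<in> component V p" "?x \<in> carrier V"
      using homogeneous_part(1) homogeneous_part_carrier x by auto
    have "Y (differential V ?x) n w = differential V (Y ?x n w)"
      using mode_differential[OF p(1) w(1), of n] w p
      by (simp add: mode_zero_right mode_closed differential_closed a_minus_zero)
    then show ?case using p w by (simp add: coboundaries_def mode_closed)
  qed
  then show ?thesis using x by simp
qed

text \<open>
  Representatives are changed one at a time: with \<open>v' = b + v\<close> and \<open>w' = c + w\<close>, the left factor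
  is changed while the right one is the cocycle \<open>w'\<close>, then the right one while the left one is \<open>v\<close>.
\<close>

lemma cohomology_mode_cls [simp]:
  assumes "v \<in> cocycles V" "w \<in> cocycles V"
  shows "cohomology_mode V Y (cls v) n (cls w) = cls (Y v n w)"
proof -
  have "cls (Y v' n w') = cls (Y v n w)" if v': "v' \<in> cls v" and w': "w' \<in> cls w" for v' w'
  proof -
    obtain b where b: "b \<in> coboundaries V" "v' = b \<oplus>\<^bsub>V\<^esub> v" using v' by (rule cls_memE)
    obtain c where c: "c \<in> coboundaries V" "w' = c \<oplus>\<^bsub>V\<^esub> w" using w' by (rule cls_memE)
    have Z: "b \<in> cocycles V" "c \<in> cocycles V" "w' \<in> cocycles V"
      using b c assms coboundaries_cocycles cocyclesE(5) by auto
    note V = Z[THEN cocycles_carrier] assms[THEN cocycles_carrier]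
    have "cls (Y v' n w') = cls (Y b n w' \<oplus>\<^bsub>V\<^esub> Y v n w')" using b V by (simp add: Y_add)
    also have "\<dots> = cls (Y v n w')"
      using mode_coboundary_left[OF b(1) Z(3)] V by (simp add: cls_add_coboundary mode_closed)
    also have "\<dots> = cls (Y v n c \<oplus>\<^bsub>V\<^esub> Y v n w)" using c V by (simp add: mode_add)
    also have "\<dots> = cls (Y v n w)"
      using mode_coboundary_right[OF assms(1) c(1)] V by (simp add: cls_add_coboundary mode_closed)
    finally show ?thesis .
  qed
  then show ?thesis
    using assms[THEN cocycles_carrier, THEN mem_cls] unfolding cohomology_mode_def by blast
qed

lemma cohomology_mode_induced:
  assumes "v \<in> cocycles V"
  shows "induces_on_cohomology V (Y v n) (cohomology_mode V Y (cls v) n)"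
  unfolding induces_on_cohomology_def
  using assms mode_cocycle mode_coboundary_right by simp

text \<open>
  Both sides are the classes of the two sides of the Jacobi identity for representatives. Passing
  the class through the sums requires finite support in the original space. Truncation provides
  it for each of the pairs \<open>(v, w)\<close>, \<open>(u, w)\<close> and \<open>(u, v)\<close>.
\<close>

lemma cohomology_jacobi:
  assumes "u \<in> cocycles V \<inter> component V p" "v \<in> cocycles V \<inter> component V q" "w \<in> cocycles V"
  shows "supp_sum (cohomology V) (\<lambda>i::nat.
         ((-1) ^ i * (of_int l gchoose i)) \<odot>\<^bsub>cohomology V\<^esub>
           (cls (Y u (m + l - int i) (Y v (n + int i) w)) \<ominus>\<^bsub>cohomology V\<^esub>
            ((-1) powi l * (-1) powi (p * q)) \<odot>\<^bsub>cohomology V\<^esub> cls (Y v (n + l - int i) (Y u (m + int i) w))))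
       = supp_sum (cohomology V) (\<lambda>i::nat.
         (of_int m gchoose i) \<odot>\<^bsub>cohomology V\<^esub> cls (Y (Y u (l + int i) v) (m + n - int i) w))"
    (is "supp_sum _ ?L = supp_sum _ ?R")
proof -
  let ?f = "\<lambda>i::nat. ((-1) ^ i * (of_int l gchoose i)) \<odot>\<^bsub>V\<^esub>
           (Y u (m + l - int i) (Y v (n + int i) w) \<ominus>\<^bsub>V\<^esub>
            ((-1) powi l * (-1) powi (p * q)) \<odot>\<^bsub>V\<^esub> Y v (n + l - int i) (Y u (m + int i) w))"
  let ?g = "\<lambda>i::nat. (of_int m gchoose i) \<odot>\<^bsub>V\<^esub> Y (Y u (l + int i) v) (m + n - int i) w"
  have uv: "u \<in> cocycles V" "v \<in> cocycles V" using assms by auto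
  note V = uv[THEN cocycles_carrier] cocycles_carrier[OF assms(3)]
  obtain N1 where N1: "\<And>k. k \<ge> N1 \<Longrightarrow> Y v k w = \<zero>\<^bsub>V\<^esub>" using truncation[of v w] V by auto
  obtain N2 where N2: "\<And>k. k \<ge> N2 \<Longrightarrow> Y u k w = \<zero>\<^bsub>V\<^esub>" using truncation[of u w] V by auto
  obtain N3 where N3: "\<And>k. k \<ge> N3 \<Longrightarrow> Y u k v = \<zero>\<^bsub>V\<^esub>" using truncation[of u v] V by auto
  have "?f i = \<zero>\<^bsub>V\<^esub>" if "i \<ge> nat (N1 - n)" "i \<ge> nat (N2 - m)" for i
    using that N1[of "n + int i"] N2[of "m + int i"] V by (simp add: mode_zero_right a_minus_zero)
  then have "{i. ?f i \<noteq> \<zero>\<^bsub>V\<^esub>} \<subseteq> {..< max (nat (N1 - n)) (nat (N2 - m))}"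
    by (auto simp: not_le[symmetric])
  then have ff: "finite {i. ?f i \<noteq> \<zero>\<^bsub>V\<^esub>}" by (rule finite_subset) simp
  have "?g i = \<zero>\<^bsub>V\<^esub>" if "i \<ge> nat (N3 - l)" for i
    using that N3[of "l + int i"] V by (simp add: mode_zero_left)
  then have "{i. ?g i \<noteq> \<zero>\<^bsub>V\<^esub>} \<subseteq> {..< nat (N3 - l)}"
    by (auto simp: not_le[symmetric])
  then have fg: "finite {i. ?g i \<noteq> \<zero>\<^bsub>V\<^esub>}" by (rule finite_subset) simp
  have Z: "?f i \<in> cocycles V" "?g i \<in> cocycles V" for i
    using uv assms(3) by (auto intro!: cocyclesE(4) cocycles_minus mode_cocycle)
  have "?L = (\<lambda>i. cls (?f i))" "?R = (\<lambda>i. cls (?g i))"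
    using uv assms(3) by (auto simp: mode_cocycle cocyclesE(4) cocycles_minus)
  then have "supp_sum (cohomology V) ?L = cls (supp_sum V ?f)"
    "supp_sum (cohomology V) ?R = cls (supp_sum V ?g)"
    using cls_supp_sum(2)[OF Z(1) ff] cls_supp_sum(2)[OF Z(2) fg] by simp_all
  moreover have "supp_sum V ?f = supp_sum V ?g"
    using jacobi[of u p v q w l m n] assms V by simp
  ultimately show ?thesis by simp
qed

lemma vac_cocycle: "vac \<in> cocycles V"
  using vac_degree vac_closed component_carrier by (auto simp: cocycles_def)

lemma cohomology_dg_vertex_algebra:
  "dg_vertex_algebra (cohomology V) (cohomology_mode V Y) (cls vac)"
proof (intro dg_vertex_algebra.intro dg_vertex_algebra_axioms.intro)
  show "cochain_complex (cohomology V)" by (rule cohomology_cochain_complex)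
  have linear: "linear_endo (cohomology V) (cohomology_mode V Y A n)"
    if "A \<in> carrier (cohomology V)" for A n
    using that unfolding linear_endo_def
    by (auto simp: mode_cocycle cocyclesE(4,5) mode_add mode_smult cocycles_carrier)
  then show "A \<in> carrier (cohomology V) \<Longrightarrow> linear_endo (cohomology V) (cohomology_mode V Y A n)" for A n .
  show "cohomology_mode V Y A n \<in> End_degree (cohomology V) (p - 2 * n - 2)"
    if A: "A \<in> component (cohomology V) p" for A n p
  proof -
    obtain v where v: "v \<in> cocycles V" "v \<in> component V p" "A = cls v" using A by auto
    have "Y v n w \<in> component V (q + (p - 2 * n - 2))" if "w \<in> component V q" for w q
      using mode_degree[OF v(2)] that unfolding End_degree_def by auto
    then show ?thesis
      using linear[of A n] v unfolding End_degree_def by (auto simp: mode_cocycle)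
  qed
  show "cohomology_mode V Y (differential (cohomology V) A) n C =
       differential (cohomology V) (cohomology_mode V Y A n C) \<ominus>\<^bsub>cohomology V\<^esub>
       ((-1) powi p) \<odot>\<^bsub>cohomology V\<^esub> cohomology_mode V Y A n (differential (cohomology V) C)"
    if "A \<in> component (cohomology V) p" "C \<in> carrier (cohomology V)" for A C n p
    using that
    by (auto simp: zero_cocycle mode_zero_left mode_zero_right cocycles_carrier a_minus_zero)
  show "\<exists>N. \<forall>n\<ge>N. cohomology_mode V Y A n C = \<zero>\<^bsub>cohomology V\<^esub>"
    if AC: "A \<in> carrier (cohomology V)" "C \<in> carrier (cohomology V)" for A C
  proof -
    obtain v w where "v \<in> cocycles V" "w \<in> cocycles V" "A = cls v" "C = cls w" using AC by auto
    moreover from this obtain N where "\<forall>n\<ge>N. Y v n w = \<zero>\<^bsub>V\<^esub>"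
      using truncation cocycles_carrier by blast
    ultimately show ?thesis by (intro exI[of _ N]) auto
  qed
  show "supp_sum (cohomology V) (\<lambda>i::nat.
         ((-1) ^ i * (of_int l gchoose i)) \<odot>\<^bsub>cohomology V\<^esub>
           (cohomology_mode V Y A (m + l - int i) (cohomology_mode V Y B (n + int i) C) \<ominus>\<^bsub>cohomology V\<^esub>
            ((-1) powi l * (-1) powi (p * q)) \<odot>\<^bsub>cohomology V\<^esub>
              cohomology_mode V Y B (n + l - int i) (cohomology_mode V Y A (m + int i) C)))
       = supp_sum (cohomology V) (\<lambda>i::nat.
         (of_int m gchoose i) \<odot>\<^bsub>cohomology V\<^esub>
           cohomology_mode V Y (cohomology_mode V Y A (l + int i) B) (m + n - int i) C)"
    if "A \<in> component (cohomology V) p" "B \<in> component (cohomology V) q"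
      "C \<in> carrier (cohomology V)" for A B C p q l m n
  proof -
    obtain u v w where *: "u \<in> cocycles V \<inter> component V p" "v \<in> cocycles V \<inter> component V q"
      "w \<in> cocycles V" "A = cls u" "B = cls v" "C = cls w"
      using \<open>A \<in> _\<close> \<open>B \<in> _\<close> \<open>C \<in> _\<close> unfolding cohomology_simps by blast
    show ?thesis using cohomology_jacobi[OF *(1-3), of l m n] * by (simp add: mode_cocycle)
  qed
qed (use vac_cocycle vac_degree in \<open>auto simp: Y_add Y_smult vacuum creation_regular creation_constant
    mode_cocycle cocyclesE(4,5) cocycles_carrier zero_cocycle\<close>)

end

theorem theorem3p10:
  fixes V :: "'a dg_space" and Y :: "'a \<Rightarrow> int \<Rightarrow> 'a \<Rightarrow> 'a" and vac :: 'a
  assumes "dg_vertex_algebra V Y vac"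
  shows "\<exists>HY :: 'a set \<Rightarrow> int \<Rightarrow> 'a set \<Rightarrow> 'a set.
    (\<forall>v\<in>cocycles V. \<forall>n. induces_on_cohomology V (Y v n) (HY (cohomology_class V v) n)) \<and>
    dg_vertex_algebra (cohomology V) HY (cohomology_class V vac)"
  using dg_vertex_algebra.cohomology_mode_induced[OF assms]
    dg_vertex_algebra.cohomology_dg_vertex_algebra[OF assms]
  by blast

end
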